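(* Let $\alpha,\beta,\gamma\in\mathbb{R}$, and let $(G_3,g,J)$ be the connected, simply connected three-dimensional Lie group with left-invariant Lorentzian metric $g$ whose Lie algebra $\mathfrak{g}$ has a pseudo-orthonormal basis $\{e_1,e_2,e_3\}$ with $e_3$ timelike such that $$[e_1,e_2]=-\gamma e_3,\quad [e_1,e_3]=-\beta e_2,\quad [e_2,e_3]=\alpha e_1,$$ equipped with the product structure $Je_1=e_1$, $Je_2=e_2$, $Je_3=-e_3$. Let $c\in\mathbb{R}$. Then $(G_3,g,J)$ is a first kind algebraic Wanas soliton associated to the canonical connection $\nabla^0$ with constant $c$ (i.e. $\mathrm{Wan}^0=c\,\mathrm{Id}+D$ with $D$ a derivation of $\mathfrak g$) if and only if one of the following holds (in each case the corresponding $D$, diagonal in the basis $e_1,e_2,e_3$, is as indicated): (i) $\alpha\neq0$, $\beta\neq0$, $\gamma=0$, $c=\frac12(\alpha-\beta)^2$; in particular $D=\mathrm{diag}\big(-\frac12(\alpha-\beta)^2,-\frac12(\alpha-\beta)^2,0\big)$. (ii) $\alpha=\beta=\gamma=0$; in particular $D=\mathrm{diag}(-c,-c,-c)$. (iii) $\alpha=\beta=0$, $\gamma\neq0$, $c=-\frac12\gamma^2$; in particular $D=0$. (iv) $\alpha=\gamma=0$, $\beta\neq0$, $c=\frac12\beta^2$; in particular $D=\mathrm{diag}\big(-\frac12\beta^2,-\frac12\beta^2,0\big)$. (v) $\alpha=0$, $\beta\neq0$, $\gamma\neq0$, $\beta=\gamma$, $c=-2\beta^2$; in particular $D=\mathrm{diag}(0,2\beta^2,2\beta^2)$.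 (vi) $\alpha\neq0$, $\beta=\gamma=0$, $c=\frac12\alpha^2$; in particular $D=\mathrm{diag}\big(-\frac12\alpha^2,-\frac12\alpha^2,0\big)$. (vii) $\alpha\neq0$, $\beta=0$, $\gamma\neq0$, $\alpha=\gamma$, $c=-2\alpha^2$; in particular $D=\mathrm{diag}(2\alpha^2,0,2\alpha^2)$.
   Context: Pseudo-orthonormal with $e_3$ timelike means $g(e_1,e_1)=g(e_2,e_2)=1$, $g(e_3,e_3)=-1$, $g(e_i,e_j)=0$ for $i\ne j$. All tensors are left-invariant and evaluated on the Lie algebra $\mathfrak{g}$ of left-invariant vector fields. Let $\nabla$ be the Levi-Civita connection of $g$, and let $J$ be the product structure given in the claim, with $(\nabla_XJ)Y=\nabla_X(JY)-J(\nabla_XY)$. Canonical connection: $\nabla^0_XY=\nabla_XY-\frac12(\nabla_XJ)JY$. Curvature: $R^0(X,Y)Z=\nabla^0_X\nabla^0_YZ-\nabla^0_Y\nabla^0_XZ-\nabla^0_{[X,Y]}Z$. Torsion: $T^0(X,Y)=\nabla^0_XY-\nabla^0_YX-[X,Y]$. $A^0(X,Y)Z=T^0(T^0(X,Y),Z)$, and the Wanas tensor is $W^0(X,Y)Z=R^0(X,Y)Z-A^0(X,Y)Z$. $w^0(X,Y)=-g(W^0(X,e_1)Y,e_1)-g(W^0(X,e_2)Y,e_2)+g(W^0(X,e_3)Y,e_3)$. The operator $\mathrm{Wan}^0:\mathfrak g\to\mathfrak g$ is defined by $w^0(X,Y)=g(\mathrm{Wan}^0(X),Y)$. A derivation of $\mathfrak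 g$ is a linear map $D$ with $D[X,Y]=[DX,Y]+[X,DY]$ for all $X,Y\in\mathfrak g$. $(G_3,g,J)$ is a first kind algebraic Wanas soliton associated to $\nabla^0$ (with constant $c$) if $\mathrm{Wan}^0=c\,\mathrm{Id}+D$ for the real number $c$ and a derivation $D$ of $\mathfrak g$. Here $D=\mathrm{diag}(d_1,d_2,d_3)$ means $De_i=d_ie_i$ for $i=1,2,3$. *)

theory Defs
  imports "HOL-Analysis.Analysis"
begin

text \<open>
  Left-invariant tensors on a Lie group are represented by their values on the Lie algebra of
  left-invariant vector fields, which is here the whole type \<open>'v\<close> with bracket \<open>br\<close>.
\<close>

definition lie_bracket :: "('v::real_vector \<Rightarrow> 'v \<Rightarrow> 'v) \<Rightarrow> bool" where
  "lie_bracket br \<longleftrightarrow>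
     bilinear br \<and> (\<forall>X. br X X = 0) \<and>
     (\<forall>X Y Z. br X (br Y Z) + br Y (br Z X) + br Z (br X Y) = 0)"

definition derivation :: "('v::real_vector \<Rightarrow> 'v \<Rightarrow> 'v) \<Rightarrow> ('v \<Rightarrow> 'v) \<Rightarrow> bool" where
  "derivation br D \<longleftrightarrow> linear D \<and> (\<forall>X Y. D (br X Y) = br (D X) Y + br X (D Y))"

definition metric_tensor :: "('v::real_vector \<Rightarrow> 'v \<Rightarrow> real) \<Rightarrow> bool" where
  "metric_tensor g \<longleftrightarrow>
     bilinear g \<and> (\<forall>X Y. g X Y = g Y X) \<and> (\<forall>X. (\<forall>Y. g X Y = 0) \<longrightarrow> X = 0)"

text \<open>A basis as below forces the signature of \<open>g\<close> to be Lorentzian, with \<open>e3\<close> timelike.\<close>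

definition pseudo_orthonormal_basis ::
    "('v::real_vector \<Rightarrow> 'v \<Rightarrow> real) \<Rightarrow> 'v \<Rightarrow> 'v \<Rightarrow> 'v \<Rightarrow> bool" where
  "pseudo_orthonormal_basis g e1 e2 e3 \<longleftrightarrow>
     distinct [e1, e2, e3] \<and> independent {e1, e2, e3} \<and> span {e1, e2, e3} = UNIV \<and>
     g e1 e1 = 1 \<and> g e2 e2 = 1 \<and> g e3 e3 = -1 \<and>
     g e1 e2 = 0 \<and> g e2 e1 = 0 \<and> g e1 e3 = 0 \<and> g e3 e1 = 0 \<and> g e2 e3 = 0 \<and> g e3 e2 = 0"

text \<open>
  For left-invariant \<open>Y\<close> and \<open>Z\<close> the function \<open>g Y Z\<close> is constant on the group, so that
  compatibility with the metric, \<open>X (g Y Z) = g (nabla X Y) Z + g Y (nabla X Z)\<close>, has left-hand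
  side \<open>0\<close>.
\<close>

definition is_levi_civita ::
    "('v::real_vector \<Rightarrow> 'v \<Rightarrow> 'v) \<Rightarrow> ('v \<Rightarrow> 'v \<Rightarrow> real) \<Rightarrow> ('v \<Rightarrow> 'v \<Rightarrow> 'v) \<Rightarrow> bool" where
  "is_levi_civita br g nabla \<longleftrightarrow>
     bilinear nabla \<and>
     (\<forall>X Y. nabla X Y - nabla Y X = br X Y) \<and>
     (\<forall>X Y Z. g (nabla X Y) Z + g Y (nabla X Z) = 0)"

definition levi_civita ::
    "('v::real_vector \<Rightarrow> 'v \<Rightarrow> 'v) \<Rightarrow> ('v \<Rightarrow> 'v \<Rightarrow> real) \<Rightarrow> 'v \<Rightarrow> 'v \<Rightarrow> 'v" where
  "levi_civita br g = (THE nabla. is_levi_civita br g nabla)"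

definition endo_derivative ::
    "('v::real_vector \<Rightarrow> 'v \<Rightarrow> 'v) \<Rightarrow> ('v \<Rightarrow> 'v) \<Rightarrow> 'v \<Rightarrow> 'v \<Rightarrow> 'v" where
  "endo_derivative nabla J X Y = nabla X (J Y) - J (nabla X Y)"

definition canonical_connection ::
    "('v::real_vector \<Rightarrow> 'v \<Rightarrow> 'v) \<Rightarrow> ('v \<Rightarrow> 'v \<Rightarrow> real) \<Rightarrow> ('v \<Rightarrow> 'v) \<Rightarrow> 'v \<Rightarrow> 'v \<Rightarrow> 'v" where
  "canonical_connection br g J X Y =
     levi_civita br g X Y - (1/2) *\<^sub>R endo_derivative (levi_civita br g) J X (J Y)"

definition curvature ::
    "('v::real_vector \<Rightarrow> 'v \<Rightarrow> 'v) \<Rightarrow> ('v \<Rightarrow> 'v \<Rightarrow> 'v) \<Rightarrow> 'v \<Rightarrow> 'v \<Rightarrow> 'v \<Rightarrow> 'v" where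
  "curvature br nabla X Y Z =
     nabla X (nabla Y Z) - nabla Y (nabla X Z) - nabla (br X Y) Z"

definition torsion ::
    "('v::real_vector \<Rightarrow> 'v \<Rightarrow> 'v) \<Rightarrow> ('v \<Rightarrow> 'v \<Rightarrow> 'v) \<Rightarrow> 'v \<Rightarrow> 'v \<Rightarrow> 'v" where
  "torsion br nabla X Y = nabla X Y - nabla Y X - br X Y"

definition wanas_tensor ::
    "('v::real_vector \<Rightarrow> 'v \<Rightarrow> 'v) \<Rightarrow> ('v \<Rightarrow> 'v \<Rightarrow> 'v) \<Rightarrow> 'v \<Rightarrow> 'v \<Rightarrow> 'v \<Rightarrow> 'v" where
  "wanas_tensor br nabla X Y Z =
     curvature br nabla X Y Z - torsion br nabla (torsion br nabla X Y) Z"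

definition wanas_form ::
    "('v::real_vector \<Rightarrow> 'v \<Rightarrow> 'v) \<Rightarrow> ('v \<Rightarrow> 'v \<Rightarrow> real) \<Rightarrow> ('v \<Rightarrow> 'v \<Rightarrow> 'v) \<Rightarrow>
     'v \<Rightarrow> 'v \<Rightarrow> 'v \<Rightarrow> 'v \<Rightarrow> 'v \<Rightarrow> real" where
  "wanas_form br g nabla e1 e2 e3 X Y =
     - g (wanas_tensor br nabla X e1 Y) e1
     - g (wanas_tensor br nabla X e2 Y) e2
     + g (wanas_tensor br nabla X e3 Y) e3"

definition wanas_operator ::
    "('v::real_vector \<Rightarrow> 'v \<Rightarrow> 'v) \<Rightarrow> ('v \<Rightarrow> 'v \<Rightarrow> real) \<Rightarrow> ('v \<Rightarrow> 'v \<Rightarrow> 'v) \<Rightarrow>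
     'v \<Rightarrow> 'v \<Rightarrow> 'v \<Rightarrow> 'v \<Rightarrow> 'v" where
  "wanas_operator br g nabla e1 e2 e3 =
     (THE W. \<forall>X Y. wanas_form br g nabla e1 e2 e3 X Y = g (W X) Y)"

definition wanas_soliton_with ::
    "('v::real_vector \<Rightarrow> 'v \<Rightarrow> 'v) \<Rightarrow> ('v \<Rightarrow> 'v \<Rightarrow> real) \<Rightarrow> ('v \<Rightarrow> 'v) \<Rightarrow>
     'v \<Rightarrow> 'v \<Rightarrow> 'v \<Rightarrow> real \<Rightarrow> ('v \<Rightarrow> 'v) \<Rightarrow> bool" where
  "wanas_soliton_with br g J e1 e2 e3 c D \<longleftrightarrow>
     derivation br D \<and>
     (\<forall>X. wanas_operator br g (canonical_connection br g J) e1 e2 e3 X = c *\<^sub>R X + D X)"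

definition first_kind_wanas_soliton ::
    "('v::real_vector \<Rightarrow> 'v \<Rightarrow> 'v) \<Rightarrow> ('v \<Rightarrow> 'v \<Rightarrow> real) \<Rightarrow> ('v \<Rightarrow> 'v) \<Rightarrow>
     'v \<Rightarrow> 'v \<Rightarrow> 'v \<Rightarrow> real \<Rightarrow> bool" where
  "first_kind_wanas_soliton br g J e1 e2 e3 c \<longleftrightarrow>
     (\<exists>D. wanas_soliton_with br g J e1 e2 e3 c D)"

definition diagonal_in ::
    "'v::real_vector \<Rightarrow> 'v \<Rightarrow> 'v \<Rightarrow> real \<Rightarrow> real \<Rightarrow> real \<Rightarrow> ('v \<Rightarrow> 'v) \<Rightarrow> bool" where
  "diagonal_in e1 e2 e3 d1 d2 d3 D \<longleftrightarrow>
     D e1 = d1 *\<^sub>R e1 \<and> D e2 = d2 *\<^sub>R e2 \<and> D e3 = d3 *\<^sub>R e3"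

end

theory Submission
  imports Defs
begin

text \<open>
  In the frame \<open>e1, e2, e3\<close> the Koszul formula gives the Levi-Civita connection explicitly. Since
  \<open>nabla0 X Y = (nabla X Y + J (nabla X (J Y))) / 2\<close> keeps only the part of \<open>nabla X\<close> commuting
  with \<open>J\<close>, the only derivatives that survive are \<open>nabla0 e3 e1 = a e2\<close> and
  \<open>nabla0 e3 e2 = - a e1\<close> with \<open>a = (\<alpha> + \<beta> - \<gamma>) / 2\<close>. The Wanas operator then comes out diagonal,
  with eigenvalues \<open>\<gamma> (\<alpha> - 3 \<beta> - \<gamma>) / 2\<close>, \<open>\<gamma> (\<beta> - 3 \<alpha> - \<gamma>) / 2\<close> and
  \<open>((\<alpha> - \<beta>)\<^sup>2 - \<gamma>\<^sup>2) / 2\<close>. A soliton forces \<open>D\<close> to be this operator minus \<open>c\<close> times the identity,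
  and a diagonal map with entries \<open>d1, d2, d3\<close> is a derivation iff \<open>\<gamma> (d3 - d1 - d2) = 0\<close>,
  \<open>\<beta> (d2 - d1 - d3) = 0\<close> and \<open>\<alpha> (d1 - d2 - d3) = 0\<close>; the cases are the solutions of this system.
\<close>

section \<open>Nondegeneracy of the metric and the uniqueness of what \<open>THE\<close>
  describes\<close>

lemma metric_tensor_eqI:
  assumes "metric_tensor g" and "\<And>Z. g X Z = g Y Z"
  shows "X = Y"
proof -
  have "bilinear g"
    using assms(1) by (simp add: metric_tensor_def)
  then have "g (X - Y) Z = 0" for Z
    using assms(2) by (simp add: bilinear_lsub)
  then have "X - Y = 0"
    using assms(1) unfolding metric_tensor_def by blast
  then show ?thesis by simp
qed

text \<open>A signed sum of the cyclic instances of torsion-freeness and metric compatibility. The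
  right-hand side involves only \<open>br\<close> and \<open>g\<close>, so by nondegeneracy it pins
  down the Levi-Civita connection; the usual derivative terms vanish because \<open>g\<close> is
  constant on left-invariant fields.\<close>

lemma koszul_formula:
  assumes g: "metric_tensor g" and nabla: "is_levi_civita br g nabla"
  shows "2 * g (nabla X Y) Z = g (br X Y) Z - g (br Y Z) X + g (br Z X) Y"
proof -
  have sym: "g U V = g V U" for U V
    using g by (simp add: metric_tensor_def)
  have torsion_free: "g (br U V) T = g (nabla U V) T - g (nabla V U) T" for U V T
    using g nabla by (metis metric_tensor_def is_levi_civita_def bilinear_lsub)
  have compat: "g (nabla U V) T + g (nabla U T) V = 0" for U V T
    using nabla sym by (metis is_levi_civita_def)
  show ?thesis
    using torsion_free[of X Y Z] torsion_free[of Y Z X] torsion_free[of Z X Y]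
      compat[of X Y Z] compat[of Y Z X] compat[of Z X Y] by linarith
qed

text \<open>Only uniqueness is settled here; existence comes later from the explicit formula in
  \<open>levi_civita_coord\<close>.\<close>

lemma levi_civita_eqI:
  assumes g: "metric_tensor g" and nabla: "is_levi_civita br g nabla"
  shows "levi_civita br g = nabla"
  unfolding levi_civita_def
proof (rule the_equality[where P = "is_levi_civita br g", OF nabla])
  fix nabla'
  assume nabla': "is_levi_civita br g nabla'"
  have "nabla' X Y = nabla X Y" for X Y
  proof (rule metric_tensor_eqI[OF g])
    show "g (nabla' X Y) Z = g (nabla X Y) Z" for Z
      using koszul_formula[OF g nabla, of X Y Z] koszul_formula[OF g nabla', of X Y Z] by simp
  qed
  then show "nabla' = nabla" by blast
qed

lemma wanas_operator_eqI:
  assumes g: "metric_tensor g"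
    and W: "\<And>X Y. wanas_form br g nabla e1 e2 e3 X Y = g (W X) Y"
  shows "wanas_operator br g nabla e1 e2 e3 = W"
  unfolding wanas_operator_def
proof (rule the_equality)
  show "\<forall>X Y. wanas_form br g nabla e1 e2 e3 X Y = g (W X) Y"
    using W by blast
  fix W'
  assume W': "\<forall>X Y. wanas_form br g nabla e1 e2 e3 X Y = g (W' X) Y"
  have "W' X = W X" for X
    by (rule metric_tensor_eqI[OF g]) (metis W W')
  then show "W' = W" by blast
qed

section \<open>Coordinates in a pseudo-orthonormal frame\<close>

locale pseudo_frame =
  fixes g :: "'v::real_vector \<Rightarrow> 'v \<Rightarrow> real"
    and e1 e2 e3 :: 'v
  assumes metric: "metric_tensor g"
    and basis: "pseudo_orthonormal_basis g e1 e2 e3"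
begin

text \<open>Components are read off by pairing with the frame; the sign in \<open>x3\<close>
  compensates for \<open>g e3 e3 = -1\<close>.\<close>

definition x1 :: "'v \<Rightarrow> real" where "x1 X = g X e1"
definition x2 :: "'v \<Rightarrow> real" where "x2 X = g X e2"
definition x3 :: "'v \<Rightarrow> real" where "x3 X = - g X e3"

definition vec :: "real \<Rightarrow> real \<Rightarrow> real \<Rightarrow> 'v" where
  "vec a b c = a *\<^sub>R e1 + b *\<^sub>R e2 + c *\<^sub>R e3"

lemma bilinear_g: "bilinear g"
  using metric by (simp add: metric_tensor_def)

lemmas g_bilinear_simps =
  bilinear_ladd[OF bilinear_g] bilinear_radd[OF bilinear_g]
  bilinear_lmul[OF bilinear_g] bilinear_rmul[OF bilinear_g]
  bilinear_lsub[OF bilinear_g] bilinear_rsub[OF bilinear_g]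
  bilinear_lneg[OF bilinear_g] bilinear_rneg[OF bilinear_g]
  bilinear_lzero[OF bilinear_g] bilinear_rzero[OF bilinear_g]

lemma g_frame [simp]:
  "g e1 e1 = 1" "g e2 e2 = 1" "g e3 e3 = -1"
  "g e1 e2 = 0" "g e2 e1 = 0" "g e1 e3 = 0" "g e3 e1 = 0" "g e2 e3 = 0" "g e3 e2 = 0"
  using basis by (simp_all add: pseudo_orthonormal_basis_def)

lemma coord_simps [simp]:
  "x1 (X + Y) = x1 X + x1 Y" "x2 (X + Y) = x2 X + x2 Y" "x3 (X + Y) = x3 X + x3 Y"
  "x1 (X - Y) = x1 X - x1 Y" "x2 (X - Y) = x2 X - x2 Y" "x3 (X - Y) = x3 X - x3 Y"
  "x1 (- X) = - x1 X" "x2 (- X) = - x2 X" "x3 (- X) = - x3 X"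
  "x1 (r *\<^sub>R X) = r * x1 X" "x2 (r *\<^sub>R X) = r * x2 X" "x3 (r *\<^sub>R X) = r * x3 X"
  "x1 0 = 0" "x2 0 = 0" "x3 0 = 0"
  "x1 e1 = 1" "x1 e2 = 0" "x1 e3 = 0"
  "x2 e1 = 0" "x2 e2 = 1" "x2 e3 = 0"
  "x3 e1 = 0" "x3 e2 = 0" "x3 e3 = 1"
  by (simp_all add: x1_def x2_def x3_def g_bilinear_simps)

lemma coord_vec [simp]:
  "x1 (vec a b c) = a" "x2 (vec a b c) = b" "x3 (vec a b c) = c"
  by (simp_all add: vec_def)

lemma vec_coord: "vec (x1 X) (x2 X) (x3 X) = X"
proof -
  have "X \<in> span {e1, e2, e3}"
    using basis by (simp add: pseudo_orthonormal_basis_def)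
  then obtain a b c where "X - a *\<^sub>R e1 - b *\<^sub>R e2 - c *\<^sub>R e3 = 0"
    by (auto simp: span_insert)
  then have "X = vec a b c"
    by (simp add: vec_def algebra_simps)
  then show ?thesis by simp
qed

text \<open>Reduces the vector identities below to three polynomial identities over the
  reals.\<close>

lemma coord_eqI: "x1 X = x1 Y \<Longrightarrow> x2 X = x2 Y \<Longrightarrow> x3 X = x3 Y \<Longrightarrow> X = Y"
  by (metis vec_coord)

lemma g_coord: "g X Y = x1 X * x1 Y + x2 X * x2 Y - x3 X * x3 Y"
proof -
  have "g X Y = g (vec (x1 X) (x2 X) (x3 X)) Y"
    by (simp add: vec_coord)
  also have "\<dots> = x1 X * g e1 Y + x2 X * g e2 Y + x3 X * g e3 Y"
    by (simp add: vec_def g_bilinear_simps)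
  finally have "g X Y = x1 X * g e1 Y + x2 X * g e2 Y + x3 X * g e3 Y" .
  moreover have "g e1 Y = x1 Y" "g e2 Y = x2 Y" "g e3 Y = - x3 Y"
    using metric by (simp_all add: metric_tensor_def x1_def x2_def x3_def)
  ultimately show ?thesis by simp
qed

lemma g_frame_right: "g X e1 = x1 X" "g X e2 = x2 X" "g X e3 = - x3 X"
  by (simp_all add: x1_def x2_def x3_def)

lemma linear_coord:
  assumes "linear f"
  shows "f X = x1 X *\<^sub>R f e1 + x2 X *\<^sub>R f e2 + x3 X *\<^sub>R f e3"
proof -
  have "f X = f (vec (x1 X) (x2 X) (x3 X))"
    by (simp add: vec_coord)
  then show ?thesis
    by (simp add: vec_def linear_add[OF assms] linear_scale[OF assms])
qed

definition diag :: "real \<Rightarrow> real \<Rightarrow> real \<Rightarrow> 'v \<Rightarrow> 'v" where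
  "diag d1 d2 d3 X = vec (d1 * x1 X) (d2 * x2 X) (d3 * x3 X)"

lemma coord_diag [simp]:
  "x1 (diag d1 d2 d3 X) = d1 * x1 X"
  "x2 (diag d1 d2 d3 X) = d2 * x2 X"
  "x3 (diag d1 d2 d3 X) = d3 * x3 X"
  by (simp_all add: diag_def)

lemma linear_diag: "linear (diag d1 d2 d3)"
  by (rule linearI; rule coord_eqI) (simp_all add: algebra_simps)

lemma diagonal_in_diag: "diagonal_in e1 e2 e3 d1 d2 d3 (diag d1 d2 d3)"
  unfolding diagonal_in_def by (intro conjI; rule coord_eqI) simp_all

end

section \<open>Connections, Wanas operator and diagonal derivations of the Lie algebra\<close>

locale g3_algebra = pseudo_frame g e1 e2 e3
  for g :: "'v::real_vector \<Rightarrow> 'v \<Rightarrow> real" and e1 e2 e3 +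
  fixes br :: "'v \<Rightarrow> 'v \<Rightarrow> 'v" and J :: "'v \<Rightarrow> 'v" and \<alpha> \<beta> \<gamma> :: real
  assumes lie: "lie_bracket br"
    and br12: "br e1 e2 = - \<gamma> *\<^sub>R e3"
    and br13: "br e1 e3 = - \<beta> *\<^sub>R e2"
    and br23: "br e2 e3 = \<alpha> *\<^sub>R e1"
    and linear_J: "linear J"
    and J_frame: "J e1 = e1" "J e2 = e2" "J e3 = - e3"
begin

lemma bilinear_br: "bilinear br"
  using lie by (simp add: lie_bracket_def)

lemma br_self: "br X X = 0"
  using lie by (simp add: lie_bracket_def)

lemma br_flip: "br X Y = - br Y X"
proof -
  have "br (X + Y) (X + Y) = br X X + br X Y + (br Y X + br Y Y)"
    by (simp only: bilinear_ladd[OF bilinear_br] bilinear_radd[OF bilinear_br] ac_simps)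
  then have "br X Y + br Y X = 0"
    by (simp only: br_self add_0 add_0_right)
  then show ?thesis
    by (simp only: eq_neg_iff_add_eq_0)
qed

lemma br_frame: "br e2 e1 = \<gamma> *\<^sub>R e3" "br e3 e1 = \<beta> *\<^sub>R e2" "br e3 e2 = - \<alpha> *\<^sub>R e1"
  using br_flip[of e2 e1] br_flip[of e3 e1] br_flip[of e3 e2] by (simp_all add: br12 br13 br23)

lemma br_coord:
  "br X Y = vec (\<alpha> * (x2 X * x3 Y - x3 X * x2 Y))
                (\<beta> * (x3 X * x1 Y - x1 X * x3 Y))
                (\<gamma> * (x2 X * x1 Y - x1 X * x2 Y))"
proof -
  have left: "linear (\<lambda>U. br U V)" and right: "linear (br V)" for V
    using bilinear_br by (simp_all add: bilinear_def)
  have expand_left: "br X Y = x1 X *\<^sub>R br e1 Y + x2 X *\<^sub>R br e2 Y + x3 X *\<^sub>R br e3 Y"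
    by (rule linear_coord[OF left])
  show ?thesis
    unfolding expand_left linear_coord[OF right, of e1 Y] linear_coord[OF right, of e2 Y]
      linear_coord[OF right, of e3 Y]
    by (intro coord_eqI) (simp_all add: br_self br12 br13 br23 br_frame algebra_simps)
qed

lemma J_coord: "J X = vec (x1 X) (x2 X) (- x3 X)"
  by (subst linear_coord[OF linear_J]) (rule coord_eqI; simp add: J_frame)

text \<open>The derivatives along \<open>e1\<close> and \<open>e2\<close> are infinitesimal boosts
  in the planes of \<open>e2, e3\<close> and \<open>e1, e3\<close>, the one along \<open>e3\<close>
  is a rotation of the plane of \<open>e1, e2\<close>. This form is forced by compatibility with
  \<open>g\<close>; torsion-freeness then fixes the three coefficients.\<close>

lemma levi_civita_coord:
  "levi_civita br g X Y =
     vec ((\<alpha> - \<beta> + \<gamma>) / 2 * x2 X * x3 Y - (\<alpha> + \<beta> - \<gamma>) / 2 * x3 X * x2 Y)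
         ((\<alpha> + \<beta> - \<gamma>) / 2 * x3 X * x1 Y + (\<alpha> - \<beta> - \<gamma>) / 2 * x1 X * x3 Y)
         ((\<alpha> - \<beta> + \<gamma>) / 2 * x2 X * x1 Y + (\<alpha> - \<beta> - \<gamma>) / 2 * x1 X * x2 Y)"
    (is "_ = ?nabla X Y")
proof -
  have "is_levi_civita br g ?nabla"
    unfolding is_levi_civita_def
  proof (intro conjI allI)
    show "bilinear ?nabla"
      unfolding bilinear_def
      by (intro conjI allI linearI; rule coord_eqI; simp; algebra)
    show "?nabla U V - ?nabla V U = br U V" for U V
      by (rule coord_eqI) (simp_all add: br_coord field_simps)
    show "g (?nabla U V) T + g V (?nabla U T) = 0" for U V T
      unfolding g_coord[of "?nabla U V" T] g_coord[of V "?nabla U T"]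
      by (simp add: field_simps)
  qed
  from levi_civita_eqI[OF metric this] show ?thesis by simp
qed

lemma canonical_connection_coord:
  "canonical_connection br g J X Y =
     vec (- ((\<alpha> + \<beta> - \<gamma>) / 2 * x3 X * x2 Y)) ((\<alpha> + \<beta> - \<gamma>) / 2 * x3 X * x1 Y) 0"
  by (rule coord_eqI)
    (simp_all add: canonical_connection_def endo_derivative_def levi_civita_coord J_coord
      field_simps)

lemma wanas_operator_coord:
  "wanas_operator br g (canonical_connection br g J) e1 e2 e3 =
     diag (\<gamma> * (\<alpha> - 3 * \<beta> - \<gamma>) / 2) (\<gamma> * (\<beta> - 3 * \<alpha> - \<gamma>) / 2) (((\<alpha> - \<beta>)\<^sup>2 - \<gamma>\<^sup>2) / 2)"
    (is "_ = ?W")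
proof (rule wanas_operator_eqI[OF metric])
  show "wanas_form br g (canonical_connection br g J) e1 e2 e3 X Y = g (?W X) Y" for X Y
    \<comment> \<open>Since \<open>g U e3 = - x3 U\<close>, all three signs in
      \<open>wanas_form\<close> agree: it is minus the trace of the map sending Z to the Wanas
      tensor of X, Z, Y.\<close>
    unfolding g_coord[of "?W X" Y] wanas_form_def g_frame_right
    by (simp add: wanas_tensor_def curvature_def torsion_def canonical_connection_coord br_coord
        power2_eq_square field_simps)
qed

lemma derivation_diag_iff:
  "derivation br (diag d1 d2 d3) \<longleftrightarrow>
     \<gamma> * (d3 - d1 - d2) = 0 \<and> \<beta> * (d2 - d1 - d3) = 0 \<and> \<alpha> * (d1 - d2 - d3) = 0"
    (is "_ \<longleftrightarrow> ?R")
proof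
  let ?D = "diag d1 d2 d3"
  assume "derivation br ?D"
  then have der: "?D (br X Y) = br (?D X) Y + br X (?D Y)" for X Y
    by (simp add: derivation_def)
  \<comment> \<open>Each bracket of frame vectors is a multiple of the third one, so a single
    component of the Leibniz rule carries the whole condition.\<close>
  have "x3 (?D (br e1 e2)) = x3 (br (?D e1) e2 + br e1 (?D e2))"
    "x2 (?D (br e1 e3)) = x2 (br (?D e1) e3 + br e1 (?D e3))"
    "x1 (?D (br e2 e3)) = x1 (br (?D e2) e3 + br e2 (?D e3))"
    by (simp_all only: der)
  then show ?R
    by (simp add: br_coord) algebra
next
  assume R: ?R
  show "derivation br (diag d1 d2 d3)"
    unfolding derivation_def
  proof (intro conjI allI)
    show "linear (diag d1 d2 d3)" by (rule linear_diag)
    show "diag d1 d2 d3 (br X Y) = br (diag d1 d2 d3 X) Y + br X (diag d1 d2 d3 Y)" for X Y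
      \<comment> \<open>With \<open>mult_eq_0_iff\<close> active, the equations in \<open>R\<close>
        would split into disjunctions; \<open>algebra\<close> needs them as polynomial
        equations.\<close>
      by (rule coord_eqI; use R in \<open>simp add: br_coord del: mult_eq_0_iff; algebra\<close>)
  qed
qed

text \<open>The soliton equation can be solved for \<open>D\<close>, so there is one candidate for
  each \<open>c\<close>, and its diagonal form is a consequence rather than an assumption.\<close>

lemma soliton_with_iff:
  "wanas_soliton_with br g J e1 e2 e3 c D \<longleftrightarrow>
     derivation br D \<and>
     D = diag (\<gamma> * (\<alpha> - 3 * \<beta> - \<gamma>) / 2 - c) (\<gamma> * (\<beta> - 3 * \<alpha> - \<gamma>) / 2 - c)
              (((\<alpha> - \<beta>)\<^sup>2 - \<gamma>\<^sup>2) / 2 - c)"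
    (is "_ \<longleftrightarrow> _ \<and> D = ?D")
proof -
  have "wanas_operator br g (canonical_connection br g J) e1 e2 e3 X = c *\<^sub>R X + ?D X" for X
    unfolding wanas_operator_coord by (rule coord_eqI) (simp_all add: algebra_simps)
  then show ?thesis
    by (auto simp: wanas_soliton_with_def fun_eq_iff)
qed

end

section \<open>Solving the scalar system for the soliton constants\<close>

lemma soliton_system_iff:
  fixes \<alpha> \<beta> \<gamma> c :: real
  defines "d1 \<equiv> \<gamma> * (\<alpha> - 3 * \<beta> - \<gamma>) / 2 - c"
    and "d2 \<equiv> \<gamma> * (\<beta> - 3 * \<alpha> - \<gamma>) / 2 - c"
    and "d3 \<equiv> ((\<alpha> - \<beta>)\<^sup>2 - \<gamma>\<^sup>2) / 2 - c"
  shows "\<gamma> * (d3 - d1 - d2) = 0 \<and> \<beta> * (d2 - d1 - d3) = 0 \<and> \<alpha> * (d1 - d2 - d3) = 0 \<longleftrightarrow>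
    \<alpha> \<noteq> 0 \<and> \<beta> \<noteq> 0 \<and> \<gamma> = 0 \<and> c = (1/2) * (\<alpha> - \<beta>)^2 \<or>
    \<alpha> = 0 \<and> \<beta> = 0 \<and> \<gamma> = 0 \<or>
    \<alpha> = 0 \<and> \<beta> = 0 \<and> \<gamma> \<noteq> 0 \<and> c = - (1/2) * \<gamma>^2 \<or>
    \<alpha> = 0 \<and> \<gamma> = 0 \<and> \<beta> \<noteq> 0 \<and> c = (1/2) * \<beta>^2 \<or>
    \<alpha> = 0 \<and> \<beta> \<noteq> 0 \<and> \<gamma> \<noteq> 0 \<and> \<beta> = \<gamma> \<and> c = - 2 * \<beta>^2 \<or>
    \<alpha> \<noteq> 0 \<and> \<beta> = 0 \<and> \<gamma> = 0 \<and> c = (1/2) * \<alpha>^2 \<or>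
    \<alpha> \<noteq> 0 \<and> \<beta> = 0 \<and> \<gamma> \<noteq> 0 \<and> \<alpha> = \<gamma> \<and> c = - 2 * \<alpha>^2"
    (is "?L \<longleftrightarrow> ?R")
proof
  assume L: ?L
  show ?R
  proof (cases "\<gamma> = 0")
    \<comment> \<open>Here \<open>d1 = d2 = - c\<close>, so the other two equations say that \<beta>
      and \<alpha> annihilate \<open>d3\<close>: either both are zero and \<open>c\<close> is free,
      or \<open>d3 = 0\<close> determines \<open>c\<close>.\<close>
    case True
    with L show ?thesis
      by (auto simp: d1_def d2_def d3_def)
  next
    case False
    \<comment> \<open>Substituting this, the other two equations become
      \<open>- 2 * \<beta> * d1 = 0\<close> and \<open>- 2 * \<alpha> * d2 = 0\<close>.\<close>
    with L have c: "d3 = d1 + d2" by simp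
    consider "\<alpha> = 0" "\<beta> = 0" | "\<alpha> = 0" "\<beta> \<noteq> 0" | "\<alpha> \<noteq> 0" "\<beta> = 0" | "\<alpha> \<noteq> 0" "\<beta> \<noteq> 0"
      by blast
    then show ?thesis
    proof cases
      case 1
      with c False show ?thesis
        by (simp add: d1_def d2_def d3_def power2_eq_square field_simps)
    next
      case 2
      with L c have d: "d1 = 0" "d2 = d3" by auto
      then have "\<beta> * (\<beta> - \<gamma>) = 0"
        using 2 by (simp add: d2_def d3_def power2_eq_square field_simps)
      with 2 have "\<beta> = \<gamma>" by simp
      with 2 d(1) False show ?thesis
        by (simp add: d1_def power2_eq_square field_simps)
    next
      case 3
      with L c have d: "d2 = 0" "d1 = d3" by auto
      then have "\<alpha> * (\<alpha> - \<gamma>) = 0"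
        using 3 by (simp add: d1_def d3_def power2_eq_square field_simps)
      with 3 have "\<alpha> = \<gamma>" by simp
      with 3 d(1) False show ?thesis
        by (simp add: d2_def power2_eq_square field_simps)
    next
      case 4
      with L c have d: "d1 = 0" "d2 = 0" "d3 = 0" by auto
      \<comment> \<open>Contradiction: \<open>d1 = d2\<close> forces \<alpha> = \<beta>, and then
        \<open>d3 - d1\<close> is a product of nonzero numbers. So no soliton has all three
        structure constants nonzero.\<close>
      have "d1 - d2 = 2 * \<gamma> * (\<alpha> - \<beta>)"
        by (simp add: d1_def d2_def field_simps)
      with d False have "\<alpha> = \<beta>" by simp
      then have "d3 - d1 = \<gamma> * \<alpha>"
        by (simp add: d1_def d3_def power2_eq_square field_simps)
      with d False 4 show ?thesis by simp
    qed
  qed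
next
  assume ?R
  then show ?L
    by (elim disjE) (auto simp: d1_def d2_def d3_def power2_eq_square field_simps)
qed

theorem theorem2p12:
  fixes \<alpha> \<beta> \<gamma> c :: real
    and br :: "'v::real_vector \<Rightarrow> 'v \<Rightarrow> 'v"
    and g :: "'v \<Rightarrow> 'v \<Rightarrow> real"
    and J :: "'v \<Rightarrow> 'v"
    and e1 e2 e3 :: 'v
  assumes "lie_bracket br"
    and "metric_tensor g"
    and "pseudo_orthonormal_basis g e1 e2 e3"
    and "br e1 e2 = - \<gamma> *\<^sub>R e3"
    and "br e1 e3 = - \<beta> *\<^sub>R e2"
    and "br e2 e3 = \<alpha> *\<^sub>R e1"
    and "linear J" and "J e1 = e1" and "J e2 = e2" and "J e3 = - e3"
  defines "case_i \<equiv> \<alpha> \<noteq> 0 \<and> \<beta> \<noteq> 0 \<and> \<gamma> = 0 \<and> c = (1/2) * (\<alpha> - \<beta>)^2"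
    and "case_ii \<equiv> \<alpha> = 0 \<and> \<beta> = 0 \<and> \<gamma> = 0"
    and "case_iii \<equiv> \<alpha> = 0 \<and> \<beta> = 0 \<and> \<gamma> \<noteq> 0 \<and> c = - (1/2) * \<gamma>^2"
    and "case_iv \<equiv> \<alpha> = 0 \<and> \<gamma> = 0 \<and> \<beta> \<noteq> 0 \<and> c = (1/2) * \<beta>^2"
    and "case_v \<equiv> \<alpha> = 0 \<and> \<beta> \<noteq> 0 \<and> \<gamma> \<noteq> 0 \<and> \<beta> = \<gamma> \<and> c = - 2 * \<beta>^2"
    and "case_vi \<equiv> \<alpha> \<noteq> 0 \<and> \<beta> = 0 \<and> \<gamma> = 0 \<and> c = (1/2) * \<alpha>^2"
    and "case_vii \<equiv> \<alpha> \<noteq> 0 \<and> \<beta> = 0 \<and> \<gamma> \<noteq> 0 \<and> \<alpha> = \<gamma> \<and> c = - 2 * \<alpha>^2"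
  shows "(first_kind_wanas_soliton br g J e1 e2 e3 c \<longleftrightarrow>
            case_i \<or> case_ii \<or> case_iii \<or> case_iv \<or> case_v \<or> case_vi \<or> case_vii) \<and>
         (\<forall>D. wanas_soliton_with br g J e1 e2 e3 c D \<longrightarrow>
            (case_i \<longrightarrow> diagonal_in e1 e2 e3 (- (1/2) * (\<alpha> - \<beta>)^2) (- (1/2) * (\<alpha> - \<beta>)^2) 0 D) \<and>
            (case_ii \<longrightarrow> diagonal_in e1 e2 e3 (- c) (- c) (- c) D) \<and>
            (case_iii \<longrightarrow> D = (\<lambda>X. 0)) \<and>
            (case_iv \<longrightarrow> diagonal_in e1 e2 e3 (- (1/2) * \<beta>^2) (- (1/2) * \<beta>^2) 0 D) \<and>
            (case_v \<longrightarrow> diagonal_in e1 e2 e3 0 (2 * \<beta>^2) (2 * \<beta>^2) D) \<and>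
            (case_vi \<longrightarrow> diagonal_in e1 e2 e3 (- (1/2) * \<alpha>^2) (- (1/2) * \<alpha>^2) 0 D) \<and>
            (case_vii \<longrightarrow> diagonal_in e1 e2 e3 (2 * \<alpha>^2) 0 (2 * \<alpha>^2) D))"
proof -
  interpret g3_algebra g e1 e2 e3 br J \<alpha> \<beta> \<gamma>
    by (intro g3_algebra.intro pseudo_frame.intro g3_algebra_axioms.intro assms(1-10))
  let ?d1 = "\<gamma> * (\<alpha> - 3 * \<beta> - \<gamma>) / 2 - c" and ?d2 = "\<gamma> * (\<beta> - 3 * \<alpha> - \<gamma>) / 2 - c"
    and ?d3 = "((\<alpha> - \<beta>)\<^sup>2 - \<gamma>\<^sup>2) / 2 - c"
  note cases_def = case_i_def case_ii_def case_iii_def case_iv_def case_v_def case_vi_def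
    case_vii_def
  have "first_kind_wanas_soliton br g J e1 e2 e3 c \<longleftrightarrow> derivation br (diag ?d1 ?d2 ?d3)"
    by (auto simp: first_kind_wanas_soliton_def soliton_with_iff)
  then have iff: "first_kind_wanas_soliton br g J e1 e2 e3 c \<longleftrightarrow>
      case_i \<or> case_ii \<or> case_iii \<or> case_iv \<or> case_v \<or> case_vi \<or> case_vii"
    unfolding cases_def derivation_diag_iff soliton_system_iff .
  \<comment> \<open>The entries enter through equations, so that each case of the list leaves only
    scalar identities to check.\<close>
  have diagonal: "diagonal_in e1 e2 e3 a1 a2 a3 D"
    if "D = diag ?d1 ?d2 ?d3" "a1 = ?d1" "a2 = ?d2" "a3 = ?d3" for D a1 a2 a3
    using that diagonal_in_diag by simp
  have zero: "D = (\<lambda>X. 0)" if "D = diag ?d1 ?d2 ?d3" "?d1 = 0" "?d2 = 0" "?d3 = 0" for D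
    unfolding that by (rule ext, rule coord_eqI) simp_all
  have "(case_i \<longrightarrow> diagonal_in e1 e2 e3 (- (1/2) * (\<alpha> - \<beta>)^2) (- (1/2) * (\<alpha> - \<beta>)^2) 0 D) \<and>
      (case_ii \<longrightarrow> diagonal_in e1 e2 e3 (- c) (- c) (- c) D) \<and>
      (case_iii \<longrightarrow> D = (\<lambda>X. 0)) \<and>
      (case_iv \<longrightarrow> diagonal_in e1 e2 e3 (- (1/2) * \<beta>^2) (- (1/2) * \<beta>^2) 0 D) \<and>
      (case_v \<longrightarrow> diagonal_in e1 e2 e3 0 (2 * \<beta>^2) (2 * \<beta>^2) D) \<and>
      (case_vi \<longrightarrow> diagonal_in e1 e2 e3 (- (1/2) * \<alpha>^2) (- (1/2) * \<alpha>^2) 0 D) \<and>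
      (case_vii \<longrightarrow> diagonal_in e1 e2 e3 (2 * \<alpha>^2) 0 (2 * \<alpha>^2) D)"
    if "wanas_soliton_with br g J e1 e2 e3 c D" for D
  proof -
    have D: "D = diag ?d1 ?d2 ?d3"
      using that by (simp add: soliton_with_iff)
    show ?thesis
      unfolding cases_def
      \<comment> \<open>The rule \<open>zero\<close> serves case (iii), where all three entries
        vanish; \<open>diagonal\<close> serves the others.\<close>
      by (intro conjI impI; (rule diagonal[OF D] | rule zero[OF D]))
        (auto simp: power2_eq_square field_simps)
  qed
  with iff show ?thesis by blast
qed

end
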